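(* Let an LCTRS with rules $\mathcal{R}$ be left-linear, left-value-free, constructor-sound, and a constructor system. For each defined or calculation symbol $f$ let $A_f=\{((\ell_1,\dots,\ell_k),\varphi)\mid \ell\to r\,[\varphi]\in\mathcal{R}\cup\mathcal{R}_{calc},\ \ell=f(\ell_1,\dots,\ell_k)\}$ (with sort sequence the argument sorts of $f$, and no variables $\vec x$). If $\mathit{OK}((),A_f,\mathsf{either})=\mathtt{true}$ holds for every defined and calculation symbol $f$, then the LCTRS is quasi-reductive.
   Context: Setting: an LCTRS with many-sorted signature $\Sigma=\Sigma_{terms}\cup\Sigma_{theory}$ and rules $\mathcal{R}$ of the form $\ell\to r\,[\varphi]$; values are constants of $\Sigma_{theory}$ in bijection with the domain of their (theory) sort; a constraint is a term over $\Sigma_{theory}$ and variables of sort $\mathsf{bool}$; a ground constraint is valid if it evaluates to true, an arbitrary constraint is valid if all instances mapping its variables to values evaluate to true. Calculation symbols are non-value symbols of $\Sigma_{theory}$, and $\mathcal{R}_{calc}=\{f(x_1,..,x_n)\to y\,[y=f(x_1,..,x_n)]\}$ over calculation symbols $f$; a rewrite step $\to_{\mathcal{R}}$ uses a rule of $\mathcal{R}\cup\mathcal{R}_{calc}$ with a substitution mapping constraint variables and fresh right-hand-side variables to values making the constraint true. Defined symbols: roots of left-hand sides in $\mathcal{R}$; constructors: the other symbols of $\Sigma_{terms}$ and all values; constructor terms consist of constructors and variables. Quasi-reductive: every ground term is a ground constructor term or reduces. Left-linear: no variable occurs twice in a left-hand side. Left-value-free: no left-hand side contains a value. Constructor-sound: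 every argument sort of a defined symbol has a ground constructor term. Constructor system: the immediate arguments of every left-hand side of a rule in $\mathcal{R}$ are constructor terms. Definition of $\mathit{OK}$: inputs are theory sorts $\iota_1..\iota_n$, sorts $\kappa_1..\kappa_m$, variables $x_1..x_n$ ($x_i:\iota_i$), a set $A$ of pairs $(\vec s,\varphi)$ with $\vec s=(s_1,..,s_m)$ value-free constructor terms, $s_i:\kappa_i$, $\varphi$ a constraint, $(x_1,..,x_n,s_1,..,s_m)$ linear, and a flag $b\in\{\mathsf{term},\mathsf{value},\mathsf{either}\}$. (1) If $m=0$: with $y_1..y_k$ the variables of constraints in $A$ other than the $x_i$, $\mathit{OK}=\mathtt{true}$ iff $\exists y_1..y_k.\bigvee_{((),\varphi)\in A}\varphi$ is valid. (2) If $m>0$, $b=\mathsf{either}$: if $\kappa_1$ does not occur in $\Sigma_{theory}$, $\mathit{OK}=\mathit{OK}(\vec x,A,\mathsf{term})$; if it does and all constructors of output sort $\kappa_1$ are values, $\mathit{OK}=\mathit{OK}(\vec x,A,\mathsf{value})$; otherwise $\mathit{OK}=\mathit{OK}(\vec x,V,\mathsf{value})\wedge\mathit{OK}(\vec x,T,\mathsf{term})$ with $V=\{(\vec s,\varphi)\in A\mid s_1$ a variable$\}$, $T=\{(\vec s,\varphi)\in A\mid s_1$ not a variable in $\mathit{Var}(\varphi)\}$. (3) If $m>0$, $b=\mathsf{value}$ (all $s_1$ variables): $\mathit{OK}=\mathit{OK}((x_1..x_{n+1}),\{((s_2..s_m),\varphi[s_1:=x_{n+1}])\mid(\vec s,\varphi)\in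 A\},\mathsf{either})$ with $x_{n+1}$ fresh of sort $\kappa_1$. (4) If $m>0$, $b=\mathsf{term}$ and all $s_1$ are variables: $\mathit{OK}=\mathit{OK}(\vec x,\{((s_2..s_m),\varphi)\mid(\vec s,\varphi)\in A\},\mathsf{either})$. (5) If $m>0$, $b=\mathsf{term}$ and some $s_1$ is not a variable: for each non-value constructor $f_i:[\mu_1\times..\times\mu_p]\Rightarrow\kappa_1$ ($i=1..k$), let $B_i$ contain, for each $(\vec s,\varphi)\in A$ with $s_1=f_i(t_1..t_p)$, the pair $((t_1..t_p,s_2..s_m),\varphi)$, and for each $(\vec s,\varphi)\in A$ with $s_1$ a variable, the pair $((y_1..y_p,s_2..s_m),\varphi[s_1:=f_i(y_1..y_p)])$ with fresh $y_j:\mu_j$; $\mathit{OK}=\bigwedge_i\mathit{OK}(\vec x,B_i,\mathsf{either})$.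
   Formalization: Right-hand-side variables not occurring in the left-hand side are required to have theory sorts, and theory sorts to have nonempty domains; otherwise f(x) → y [true] with y of a sort without values passes OK but never applies, so the claim fails. *)

theory Defs
  imports Main
begin

datatype (symbols: 'f, vars: 'v) "term" =
  is_Var: Var 'v
| Fun 'f "('f, 'v) term list"

primrec subst :: "('f, 'v) term \<Rightarrow> ('v \<Rightarrow> ('f, 'v) term) \<Rightarrow> ('f, 'v) term" (infixl "\<cdot>" 67) where
  "Var x \<cdot> \<sigma> = \<sigma> x"
| "Fun f ts \<cdot> \<sigma> = Fun f (map (\<lambda>t. t \<cdot> \<sigma>) ts)"

primrec var_occs :: "('f, 'v) term \<Rightarrow> 'v list" where
  "var_occs (Var x) = [x]"
| "var_occs (Fun f ts) = concat (map var_occs ts)"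

definition ground :: "('f, 'v) term \<Rightarrow> bool" where
  "ground t \<longleftrightarrow> vars t = {}"

text \<open>A triple \<open>(l, r, \<phi>)\<close> is the constrained rule \<open>l \<rightarrow> r [\<phi>]\<close>.\<close>

type_synonym ('f, 'v) crule = "('f, 'v) term \<times> ('f, 'v) term \<times> ('f, 'v) term"

text \<open>The interpretations of all theory sorts live in one type \<open>'d\<close>; the truth values are the
  elements \<open>tt\<close> and \<open>ff\<close> of it. The sort declaration \<open>[\<iota>\<^sub>1 \<times> \<dots> \<times> \<iota>\<^sub>n] \<Rightarrow> \<kappa>\<close> of a symbol is the pair
  \<open>([\<iota>\<^sub>1, \<dots>, \<iota>\<^sub>n], \<kappa>)\<close>, and \<open>eq_sym \<iota>\<close> is the equality symbol of the theory sort \<open>\<iota>\<close>.\<close>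

record ('f, 'v, 's, 'd) lctrs =
  sig_terms :: "'f set"
  sig_theory :: "'f set"
  vals :: "'f set"
  decl :: "'f \<Rightarrow> 's list \<times> 's"
  var_sort :: "'v \<Rightarrow> 's"
  interp_sort :: "'s \<Rightarrow> 'd set"
  interp_sym :: "'f \<Rightarrow> 'd list \<Rightarrow> 'd"
  bool_sort :: 's
  tt :: 'd
  ff :: 'd
  eq_sym :: "'s \<Rightarrow> 'f"
  rules :: "('f, 'v) crule set"

abbreviation arg_sorts :: "('f, 'v, 's, 'd) lctrs \<Rightarrow> 'f \<Rightarrow> 's list" where
  "arg_sorts L f \<equiv> fst (decl L f)"

abbreviation out_sort :: "('f, 'v, 's, 'd) lctrs \<Rightarrow> 'f \<Rightarrow> 's" where
  "out_sort L f \<equiv> snd (decl L f)"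

definition sig :: "('f, 'v, 's, 'd) lctrs \<Rightarrow> 'f set" where
  "sig L = sig_terms L \<union> sig_theory L"

definition theory_sorts :: "('f, 'v, 's, 'd) lctrs \<Rightarrow> 's set" where
  "theory_sorts L = (\<Union>f \<in> sig_theory L. insert (out_sort L f) (set (arg_sorts L f)))"

text \<open>\<open>has_sort L F t \<iota>\<close>: \<open>t\<close> is a well-sorted term of sort \<open>\<iota>\<close> over the symbols in \<open>F\<close> and
  variables.\<close>

inductive has_sort ::
  "('f, 'v, 's, 'd) lctrs \<Rightarrow> 'f set \<Rightarrow> ('f, 'v) term \<Rightarrow> 's \<Rightarrow> bool" for L F where
  Var: "has_sort L F (Var x) (var_sort L x)"
| Fun: "f \<in> F \<Longrightarrow> list_all2 (has_sort L F) ts (arg_sorts L f)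
    \<Longrightarrow> has_sort L F (Fun f ts) (out_sort L f)"

definition values_of :: "('f, 'v, 's, 'd) lctrs \<Rightarrow> 's \<Rightarrow> 'f set" where
  "values_of L \<iota> = {v \<in> vals L. decl L v = ([], \<iota>)}"

definition value_term :: "('f, 'v, 's, 'd) lctrs \<Rightarrow> 's \<Rightarrow> ('f, 'v) term \<Rightarrow> bool" where
  "value_term L \<iota> t \<longleftrightarrow> (\<exists>v \<in> values_of L \<iota>. t = Fun v [])"

text \<open>Meaningful only on ground terms over the theory signature.\<close>

primrec eval_ground :: "('f, 'v, 's, 'd) lctrs \<Rightarrow> ('f, 'v) term \<Rightarrow> 'd" where
  "eval_ground L (Var x) = undefined"
| "eval_ground L (Fun f ts) = interp_sym L f (map (eval_ground L) ts)"

definition is_constraint :: "('f, 'v, 's, 'd) lctrs \<Rightarrow> ('f, 'v) term \<Rightarrow> bool" where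
  "is_constraint L \<phi> \<longleftrightarrow> has_sort L (sig_theory L) \<phi> (bool_sort L)"

definition calc_symbols :: "('f, 'v, 's, 'd) lctrs \<Rightarrow> 'f set" where
  "calc_symbols L = sig_theory L - vals L"

text \<open>Fresh right-hand side variables may only be instantiated by values, so they are required
  to have a theory sort; a rule with a fresh variable of another sort could never be applied.\<close>

definition wf_rule :: "('f, 'v, 's, 'd) lctrs \<Rightarrow> ('f, 'v) crule \<Rightarrow> bool" where
  "wf_rule L = (\<lambda>(l, r, \<phi>).
     \<not> is_Var l \<and>
     (\<exists>\<iota>. has_sort L (sig L) l \<iota> \<and> has_sort L (sig L) r \<iota>) \<and>
     is_constraint L \<phi> \<and>
     var_sort L ` (vars r - vars l) \<subseteq> theory_sorts L)"

definition is_lctrs :: "('f, 'v, 's, 'd) lctrs \<Rightarrow> bool" where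
  "is_lctrs L \<longleftrightarrow>
     (\<forall>\<iota>. infinite {x. var_sort L x = \<iota>}) \<and>
     vals L \<subseteq> sig_theory L \<and>
     (\<forall>v \<in> vals L. arg_sorts L v = []) \<and>
     (\<forall>\<iota> \<in> theory_sorts L. interp_sort L \<iota> \<noteq> {} \<and>
        bij_betw (\<lambda>v. interp_sym L v []) (values_of L \<iota>) (interp_sort L \<iota>)) \<and>
     (\<forall>f \<in> sig_theory L. \<forall>ds. list_all2 (\<lambda>d \<iota>. d \<in> interp_sort L \<iota>) ds (arg_sorts L f)
        \<longrightarrow> interp_sym L f ds \<in> interp_sort L (out_sort L f)) \<and>
     bool_sort L \<in> theory_sorts L \<and>
     interp_sort L (bool_sort L) = {tt L, ff L} \<and> tt L \<noteq> ff L \<and>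
     (\<forall>f \<in> calc_symbols L. let \<iota> = out_sort L f; e = eq_sym L \<iota> in
        e \<in> sig_theory L \<and> decl L e = ([\<iota>, \<iota>], bool_sort L) \<and>
        (\<forall>a \<in> interp_sort L \<iota>. \<forall>b \<in> interp_sort L \<iota>.
           interp_sym L e [a, b] = (if a = b then tt L else ff L))) \<and>
     (\<forall>\<rho> \<in> rules L. wf_rule L \<rho>)"

text \<open>The calculation rule \<open>f(x\<^sub>1, \<dots>, x\<^sub>n) \<rightarrow> y [y = f(x\<^sub>1, \<dots>, x\<^sub>n)]\<close>. Its variables are arbitrary but
  fixed, so that there is one rule per calculation symbol rather than one per renaming; otherwise
  the calculation rules would already use up all variables and leave no fresh ones.\<close>

definition calc_vars :: "('f, 'v, 's, 'd) lctrs \<Rightarrow> 'f \<Rightarrow> 'v list" where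
  "calc_vars L f =
     (SOME zs. distinct zs \<and> map (var_sort L) zs = out_sort L f # arg_sorts L f)"

definition calc_rule :: "('f, 'v, 's, 'd) lctrs \<Rightarrow> 'f \<Rightarrow> ('f, 'v) crule" where
  "calc_rule L f =
     (let y = Var (hd (calc_vars L f)); fx = Fun f (map Var (tl (calc_vars L f)))
      in (fx, y, Fun (eq_sym L (out_sort L f)) [y, fx]))"

definition all_rules :: "('f, 'v, 's, 'd) lctrs \<Rightarrow> ('f, 'v) crule set" where
  "all_rules L = rules L \<union> calc_rule L ` calc_symbols L"

definition respects_rule ::
  "('f, 'v, 's, 'd) lctrs \<Rightarrow> ('v \<Rightarrow> ('f, 'v) term) \<Rightarrow> ('f, 'v) crule \<Rightarrow> bool" where
  "respects_rule L \<gamma> = (\<lambda>(l, r, \<phi>).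
     (\<forall>x \<in> vars \<phi> \<union> (vars r - vars l). value_term L (var_sort L x) (\<gamma> x)) \<and>
     eval_ground L (\<phi> \<cdot> \<gamma>) = tt L)"

inductive rstep ::
  "('f, 'v, 's, 'd) lctrs \<Rightarrow> ('f, 'v) term \<Rightarrow> ('f, 'v) term \<Rightarrow> bool" for L where
  root: "(l, r, \<phi>) \<in> all_rules L \<Longrightarrow> (\<And>x. has_sort L (sig L) (\<gamma> x) (var_sort L x))
    \<Longrightarrow> respects_rule L \<gamma> (l, r, \<phi>) \<Longrightarrow> rstep L (l \<cdot> \<gamma>) (r \<cdot> \<gamma>)"
| ctxt: "rstep L s t \<Longrightarrow> rstep L (Fun f (us @ s # vs)) (Fun f (us @ t # vs))"

definition defined_symbols :: "('f, 'v, 's, 'd) lctrs \<Rightarrow> 'f set" where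
  "defined_symbols L = {f. \<exists>ts r \<phi>. (Fun f ts, r, \<phi>) \<in> rules L}"

definition constructors :: "('f, 'v, 's, 'd) lctrs \<Rightarrow> 'f set" where
  "constructors L = (sig_terms L - defined_symbols L) \<union> vals L"

definition nonvalue_constructors_of :: "('f, 'v, 's, 'd) lctrs \<Rightarrow> 's \<Rightarrow> 'f set" where
  "nonvalue_constructors_of L \<kappa> = {f \<in> constructors L - vals L. out_sort L f = \<kappa>}"

definition quasi_reductive :: "('f, 'v, 's, 'd) lctrs \<Rightarrow> bool" where
  "quasi_reductive L \<longleftrightarrow>
     (\<forall>t \<iota>. ground t \<and> has_sort L (sig L) t \<iota>
        \<longrightarrow> has_sort L (constructors L) t \<iota> \<or> (\<exists>u. rstep L t u))"

definition left_linear :: "('f, 'v, 's, 'd) lctrs \<Rightarrow> bool" where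
  "left_linear L \<longleftrightarrow> (\<forall>(l, r, \<phi>) \<in> rules L. distinct (var_occs l))"

definition left_value_free :: "('f, 'v, 's, 'd) lctrs \<Rightarrow> bool" where
  "left_value_free L \<longleftrightarrow> (\<forall>(l, r, \<phi>) \<in> rules L. symbols l \<inter> vals L = {})"

definition constructor_sound :: "('f, 'v, 's, 'd) lctrs \<Rightarrow> bool" where
  "constructor_sound L \<longleftrightarrow>
     (\<forall>f \<in> defined_symbols L. \<forall>\<iota> \<in> set (arg_sorts L f).
        \<exists>t :: ('f, 'v) term. ground t \<and> has_sort L (constructors L) t \<iota>)"

definition constructor_system :: "('f, 'v, 's, 'd) lctrs \<Rightarrow> bool" where
  "constructor_system L \<longleftrightarrow>
     (\<forall>f ts r \<phi>. (Fun f ts, r, \<phi>) \<in> rules L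
        \<longrightarrow> (\<forall>t \<in> set ts. \<exists>\<iota>. has_sort L (constructors L) t \<iota>))"

text \<open>Validity of the formula \<open>\<exists>y\<^sub>1 \<dots> y\<^sub>k. \<Or>\<Phi>\<close>, where the \<open>y\<^sub>j\<close> are the variables of \<open>\<Phi>\<close> outside the
  list \<open>xs\<close>.\<close>

definition valid_ex_disj ::
  "('f, 'v, 's, 'd) lctrs \<Rightarrow> 'v list \<Rightarrow> ('f, 'v) term set \<Rightarrow> bool" where
  "valid_ex_disj L xs \<Phi> \<longleftrightarrow>
     (\<forall>\<gamma>. (\<forall>x \<in> set xs. value_term L (var_sort L x) (\<gamma> x)) \<longrightarrow>
        (\<exists>\<delta>. (\<forall>x \<in> set xs. \<delta> x = \<gamma> x) \<and>
             (\<forall>y \<in> \<Union>(vars ` \<Phi>) - set xs. value_term L (var_sort L y) (\<delta> y)) \<and>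
             (\<exists>\<phi> \<in> \<Phi>. eval_ground L (\<phi> \<cdot> \<delta>) = tt L)))"

datatype flag = Term_Flag | Value_Flag | Either_Flag

type_synonym ('f, 'v) pattern = "('f, 'v) term list \<times> ('f, 'v) term"

definition pattern_vars :: "('f, 'v) pattern set \<Rightarrow> 'v set" where
  "pattern_vars A = (\<Union>(ss, \<phi>) \<in> A. \<Union>(vars ` set ss) \<union> vars \<phi>)"

abbreviation subst1 :: "('f, 'v) term \<Rightarrow> 'v \<Rightarrow> ('f, 'v) term \<Rightarrow> ('f, 'v) term" where
  "subst1 \<phi> x t \<equiv> \<phi> \<cdot> (Var(x := t))"

text \<open>\<open>OK L xs \<kappa>s A b\<close> states that the recursive procedure OK yields true on the theory-sorted
  variables \<open>xs\<close>, the sorts \<open>\<kappa>s\<close>, the set \<open>A\<close> and the flag \<open>b\<close>. The clauses are the recursive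
  equations of the procedure, and their side conditions are mutually exclusive. Intended inputs
  are those where every \<open>(ss, \<phi>) \<in> A\<close> consists of a list \<open>ss\<close> of value-free constructor terms of
  sorts \<open>\<kappa>s\<close> and a constraint \<open>\<phi>\<close> such that \<open>map Var xs @ ss\<close> is linear. The fresh variables are
  left open because the result does not depend on them.\<close>

inductive OK :: "('f, 'v, 's, 'd) lctrs \<Rightarrow> 'v list \<Rightarrow> 's list \<Rightarrow> ('f, 'v) pattern set
    \<Rightarrow> flag \<Rightarrow> bool" for L where
  no_terms:
    "valid_ex_disj L xs (snd ` A) \<Longrightarrow> OK L xs [] A b"
| either_term:
    "\<kappa> \<notin> theory_sorts L
     \<Longrightarrow> OK L xs (\<kappa> # \<kappa>s) A Term_Flag
     \<Longrightarrow> OK L xs (\<kappa> # \<kappa>s) A Either_Flag"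
| either_value:
    "\<kappa> \<in> theory_sorts L \<Longrightarrow> nonvalue_constructors_of L \<kappa> = {}
     \<Longrightarrow> OK L xs (\<kappa> # \<kappa>s) A Value_Flag
     \<Longrightarrow> OK L xs (\<kappa> # \<kappa>s) A Either_Flag"
| either_both:
    "\<kappa> \<in> theory_sorts L \<Longrightarrow> nonvalue_constructors_of L \<kappa> \<noteq> {}
     \<Longrightarrow> OK L xs (\<kappa> # \<kappa>s) {(ss, \<phi>) \<in> A. is_Var (hd ss)} Value_Flag
     \<Longrightarrow> OK L xs (\<kappa> # \<kappa>s) {(ss, \<phi>) \<in> A. hd ss \<notin> Var ` vars \<phi>} Term_Flag
     \<Longrightarrow> OK L xs (\<kappa> # \<kappa>s) A Either_Flag"
| value_flag:
    "\<forall>(ss, \<phi>) \<in> A. is_Var (hd ss)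
     \<Longrightarrow> x \<notin> set xs \<union> pattern_vars A \<Longrightarrow> var_sort L x = \<kappa>
     \<Longrightarrow> OK L (xs @ [x]) \<kappa>s {(ss, subst1 \<phi> z (Var x)) | z ss \<phi>. (Var z # ss, \<phi>) \<in> A} Either_Flag
     \<Longrightarrow> OK L xs (\<kappa> # \<kappa>s) A Value_Flag"
| term_flag_vars:
    "\<forall>(ss, \<phi>) \<in> A. is_Var (hd ss)
     \<Longrightarrow> OK L xs \<kappa>s {(ss, \<phi>) | z ss \<phi>. (Var z # ss, \<phi>) \<in> A} Either_Flag
     \<Longrightarrow> OK L xs (\<kappa> # \<kappa>s) A Term_Flag"
| term_flag_split:
    "\<exists>(ss, \<phi>) \<in> A. \<not> is_Var (hd ss)
     \<Longrightarrow> (\<And>f. f \<in> nonvalue_constructors_of L \<kappa> \<Longrightarrow>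
           distinct (ys f) \<and> map (var_sort L) (ys f) = arg_sorts L f \<and>
           set (ys f) \<inter> (set xs \<union> pattern_vars A) = {})
     \<Longrightarrow> (\<And>f. f \<in> nonvalue_constructors_of L \<kappa> \<Longrightarrow>
           OK L xs (arg_sorts L f @ \<kappa>s)
             ({(ts @ ss, \<phi>) | ts ss \<phi>. (Fun f ts # ss, \<phi>) \<in> A} \<union>
              {(map Var (ys f) @ ss, subst1 \<phi> z (Fun f (map Var (ys f)))) | z ss \<phi>.
                 (Var z # ss, \<phi>) \<in> A})
             Either_Flag)
     \<Longrightarrow> OK L xs (\<kappa> # \<kappa>s) A Term_Flag"

definition lhs_patterns :: "('f, 'v, 's, 'd) lctrs \<Rightarrow> 'f \<Rightarrow> ('f, 'v) pattern set" where
  "lhs_patterns L f = {(ls, \<phi>). \<exists>r. (Fun f ls, r, \<phi>) \<in> all_rules L}"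

end

theory Submission
  imports Defs
begin

text \<open>If \<open>OK\<close> accepts \<open>A\<close>, then each tuple of ground constructor terms is matched by a pattern of \<open>A\<close>
  whose constraint holds under the matching substitution; this goes by induction on \<open>OK\<close>. The
  induction needs that in term mode a variable at the first position never occurs in the
  constraint, so that it may be instantiated by a non-value and the substitution into the constraint
  in the splitting clause is vacuous. Quasi-reductivity follows by looking at an innermost
  non-constructor symbol.\<close>

section \<open>Substitutions and variable occurrences\<close>

lemma subst_cong: "(\<And>x. x \<in> vars t \<Longrightarrow> \<sigma> x = \<tau> x) \<Longrightarrow> t \<cdot> \<sigma> = t \<cdot> \<tau>"
  by (induction t) auto

lemma subst_Var [simp]: "t \<cdot> Var = t"
  by (induction t) (auto intro: map_idI)

lemma subst_subst: "t \<cdot> \<sigma> \<cdot> \<tau> = t \<cdot> (\<lambda>x. \<sigma> x \<cdot> \<tau>)"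
  by (induction t) auto

lemma vars_subst: "vars (t \<cdot> \<sigma>) = (\<Union>x \<in> vars t. vars (\<sigma> x))"
  by (induction t) auto

lemma set_var_occs [simp]: "set (var_occs t) = vars t"
  by (induction t) auto

lemma subst_upd_idle: "z \<notin> vars t \<Longrightarrow> t \<cdot> \<sigma>(z := s) = t \<cdot> \<sigma>"
  by (rule subst_cong) auto

lemma subst1_idle: "z \<notin> vars t \<Longrightarrow> subst1 t z s = t"
  by (simp add: subst_upd_idle)

lemma map_subst_upd_idle:
  "z \<notin> \<Union>(vars ` set ts) \<Longrightarrow> map (\<lambda>t. t \<cdot> \<sigma>(z := s)) ts = map (\<lambda>t. t \<cdot> \<sigma>) ts"
  by (auto simp: subst_upd_idle)

lemma subst1_rename: "subst1 \<phi> z (Var x) \<cdot> \<sigma> = \<phi> \<cdot> \<sigma>(z := \<sigma> x)"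
  unfolding subst_subst by (rule subst_cong) auto

section \<open>Sorts of terms and of their variables\<close>

lemma has_sort_mono:
  assumes "has_sort L F t \<iota>" "F \<subseteq> G"
  shows "has_sort L G t \<iota>"
  using assms(1)
proof induction
  case (Fun f ts)
  then show ?case using assms(2) by (auto intro!: has_sort.Fun elim!: list_all2_mono)
qed (rule has_sort.Var)

lemma has_sort_Var_iff [simp]: "has_sort L F (Var x) \<iota> \<longleftrightarrow> \<iota> = var_sort L x"
  by (auto elim: has_sort.cases intro: has_sort.Var)

lemma has_sort_Fun_iff [simp]:
  "has_sort L F (Fun f ts) \<iota> \<longleftrightarrow>
     f \<in> F \<and> list_all2 (has_sort L F) ts (arg_sorts L f) \<and> \<iota> = out_sort L f"
  by (auto elim: has_sort.cases intro: has_sort.Fun)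

text \<open>Argument sorts of theory symbols are theory sorts by definition, so the claim passes
  down to the variables; for a bare variable it is the assumption on \<open>\<iota>\<close>. Applied
  to constraints, it shows that their variables range over sorts that have values.\<close>

lemma has_sort_vars_theory:
  assumes "has_sort L F t \<iota>" "F \<subseteq> sig_theory L" "\<iota> \<in> theory_sorts L"
  shows "\<forall>x \<in> vars t. var_sort L x \<in> theory_sorts L"
  using assms
proof induction
  case (Fun f ts)
  have "set (arg_sorts L f) \<subseteq> theory_sorts L"
    using Fun.hyps Fun.prems by (auto simp: theory_sorts_def)
  moreover from Fun.IH have "\<forall>x \<in> vars t. var_sort L x \<in> theory_sorts L"
    if "t \<in> set ts" "set (arg_sorts L f) \<subseteq> theory_sorts L" for t
    using that Fun.prems(1) unfolding list_all2_conv_all_nth in_set_conv_nth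
    by (metis nth_mem subsetD)
  ultimately show ?case by fastforce
qed simp

lemma constructors_subset_sig: "is_lctrs L \<Longrightarrow> constructors L \<subseteq> sig L"
  by (auto simp: is_lctrs_def constructors_def sig_def)

section \<open>Values and ground constructor terms\<close>

lemma vals_decl: "\<lbrakk>is_lctrs L; v \<in> vals L\<rbrakk> \<Longrightarrow> decl L v = ([], out_sort L v)"
  by (auto simp: is_lctrs_def prod_eq_iff)

lemma vals_theory_sort: "\<lbrakk>is_lctrs L; v \<in> vals L\<rbrakk> \<Longrightarrow> out_sort L v \<in> theory_sorts L"
  by (auto simp: is_lctrs_def theory_sorts_def)

lemma value_term_has_sort:
  assumes "is_lctrs L" "value_term L \<iota> t"
  shows "has_sort L (sig L) t \<iota>"
  using assms by (auto simp: value_term_def values_of_def is_lctrs_def sig_def)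

lemma value_term_theory_sort: "\<lbrakk>is_lctrs L; value_term L \<iota> t\<rbrakk> \<Longrightarrow> \<iota> \<in> theory_sorts L"
  by (auto simp: value_term_def values_of_def dest: vals_theory_sort)

lemma ex_value_term:
  assumes "is_lctrs L" "\<iota> \<in> theory_sorts L"
  shows "\<exists>t. value_term L \<iota> t"
proof -
  have "interp_sort L \<iota> \<noteq> {}" "bij_betw (\<lambda>v. interp_sym L v []) (values_of L \<iota>) (interp_sort L \<iota>)"
    using assms by (auto simp: is_lctrs_def)
  then have "values_of L \<iota> \<noteq> {}" by (auto simp: bij_betw_def)
  then show ?thesis by (auto simp: value_term_def)
qed

text \<open>A value symbol has no arguments, so a ground constructor term with such a root is itself
  a value. The resulting dichotomy is the one behind \<open>Value_Flag\<close> and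
  \<open>Term_Flag\<close>.\<close>

lemma ground_constructor_term_cases:
  assumes "is_lctrs L" "ground t" "has_sort L (constructors L) t \<kappa>" "\<not> value_term L \<kappa> t"
  obtains f ts where "t = Fun f ts" "f \<in> nonvalue_constructors_of L \<kappa>"
    "list_all2 (\<lambda>t \<iota>. ground t \<and> has_sort L (constructors L) t \<iota>) ts (arg_sorts L f)"
proof (cases t)
  case (Var x)
  then show ?thesis using assms by (simp add: ground_def)
next
  case (Fun f ts)
  have "f \<notin> vals L"
    using assms(3,4) vals_decl[OF assms(1), of f] unfolding Fun
    by (auto simp: value_term_def values_of_def prod_eq_iff)
  moreover have "\<forall>t \<in> set ts. ground t" using assms(2) Fun by (simp add: ground_def)
  ultimately show ?thesis using that Fun assms(3)
    by (auto simp: nonvalue_constructors_of_def list_all2_conv_all_nth)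
qed

section \<open>Patterns that cover a tuple of ground terms\<close>

text \<open>The invariant of the recursion. Linearity jointly with \<open>xs\<close> lets a matcher
  be changed at the first variable without disturbing anything else; the condition on
  \<open>\<phi>\<close> keeps variables of other sorts out of constraints.\<close>

definition well_formed_patterns ::
  "('f, 'v, 's, 'd) lctrs \<Rightarrow> 'v list \<Rightarrow> 's list \<Rightarrow> ('f, 'v) pattern set \<Rightarrow> bool" where
  "well_formed_patterns L xs \<kappa>s A \<longleftrightarrow> (\<forall>(ss, \<phi>) \<in> A.
     list_all2 (has_sort L (sig L)) ss \<kappa>s \<and>
     distinct (xs @ concat (map var_occs ss)) \<and>
     (\<forall>x \<in> vars \<phi>. var_sort L x \<in> theory_sorts L))"

text \<open>The semantic meaning of acceptance by \<open>OK\<close>: \<open>\<gamma>\<close> fixes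
  the variables already split off into \<open>xs\<close>, and \<open>\<delta>\<close> extends it to
  a matcher that satisfies the constraint. \<open>\<delta>\<close> is well-sorted on all variables
  because \<open>rstep\<close> demands this of its substitution.\<close>

definition covers ::
  "('f, 'v, 's, 'd) lctrs \<Rightarrow> 'v list \<Rightarrow> ('v \<Rightarrow> ('f, 'v) term) \<Rightarrow> ('f, 'v) pattern set \<Rightarrow>
     ('f, 'v) term list \<Rightarrow> bool" where
  "covers L xs \<gamma> A ts \<longleftrightarrow> (\<exists>(ss, \<phi>) \<in> A. \<exists>\<delta>.
     (\<forall>x \<in> set xs. \<delta> x = \<gamma> x) \<and> (\<forall>x. has_sort L (sig L) (\<delta> x) (var_sort L x)) \<and>
     map (\<lambda>s. s \<cdot> \<delta>) ss = ts \<and>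
     (\<forall>x \<in> vars \<phi>. value_term L (var_sort L x) (\<delta> x)) \<and> eval_ground L (\<phi> \<cdot> \<delta>) = tt L)"

lemma coversI:
  assumes "(ss, \<phi>) \<in> A" "\<And>x. x \<in> set xs \<Longrightarrow> \<delta> x = \<gamma> x"
    "\<And>x. has_sort L (sig L) (\<delta> x) (var_sort L x)" "map (\<lambda>s. s \<cdot> \<delta>) ss = ts"
    "\<And>x. x \<in> vars \<phi> \<Longrightarrow> value_term L (var_sort L x) (\<delta> x)" "eval_ground L (\<phi> \<cdot> \<delta>) = tt L"
  shows "covers L xs \<gamma> A ts"
  using assms unfolding covers_def by blast

lemma coversE:
  assumes "covers L xs \<gamma> A ts"
  obtains ss \<phi> \<delta> where "(ss, \<phi>) \<in> A" "\<And>x. x \<in> set xs \<Longrightarrow> \<delta> x = \<gamma> x"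
    "\<And>x. has_sort L (sig L) (\<delta> x) (var_sort L x)" "map (\<lambda>s. s \<cdot> \<delta>) ss = ts"
    "\<And>x. x \<in> vars \<phi> \<Longrightarrow> value_term L (var_sort L x) (\<delta> x)" "eval_ground L (\<phi> \<cdot> \<delta>) = tt L"
  using assms unfolding covers_def by blast

lemma well_formed_patternsD:
  assumes "well_formed_patterns L xs \<kappa>s A" "(ss, \<phi>) \<in> A"
  shows "list_all2 (has_sort L (sig L)) ss \<kappa>s" "distinct (xs @ concat (map var_occs ss))"
    "\<forall>x \<in> vars \<phi>. var_sort L x \<in> theory_sorts L"
  using assms unfolding well_formed_patterns_def by blast+

lemma covers_mono: "\<lbrakk>covers L xs \<gamma> B ts; B \<subseteq> A\<rbrakk> \<Longrightarrow> covers L xs \<gamma> A ts"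
  unfolding covers_def by blast

lemma well_formed_patterns_mono:
  "\<lbrakk>well_formed_patterns L xs \<kappa>s A; B \<subseteq> A\<rbrakk> \<Longrightarrow> well_formed_patterns L xs \<kappa>s B"
  unfolding well_formed_patterns_def by blast

lemma covers_no_terms:
  assumes L: "is_lctrs L" and wf: "well_formed_patterns L xs [] A"
    and valid: "valid_ex_disj L xs (snd ` A)"
    and \<gamma>: "\<forall>x \<in> set xs. value_term L (var_sort L x) (\<gamma> x)"
  shows "covers L xs \<gamma> A []"
proof -
  obtain \<delta> ss \<phi> where \<delta>: "\<forall>x \<in> set xs. \<delta> x = \<gamma> x"
    "\<forall>y \<in> \<Union>(vars ` snd ` A) - set xs. value_term L (var_sort L y) (\<delta> y)"
    and A: "(ss, \<phi>) \<in> A" and true: "eval_ground L (\<phi> \<cdot> \<delta>) = tt L"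
    using valid \<gamma> unfolding valid_ex_disj_def by (smt (verit) imageE prod.collapse)
  have val: "value_term L (var_sort L x) (\<delta> x)" if "x \<in> vars \<phi> \<union> set xs" for x
  proof (cases "x \<in> set xs")
    case False
    with that have "x \<in> vars (snd (ss, \<phi>))" by simp
    with A False \<delta>(2) show ?thesis by blast
  qed (use \<delta>(1) \<gamma> in simp)
  \<comment> \<open>Validity says nothing about \<open>\<delta>\<close> on variables foreign to
    \<open>A\<close> and \<open>xs\<close>, where it may be ill-sorted; the identity is well-sorted
    there.\<close>
  let ?\<delta> = "\<lambda>x. if x \<in> vars \<phi> \<union> set xs then \<delta> x else Var x"
  have "\<phi> \<cdot> ?\<delta> = \<phi> \<cdot> \<delta>" by (rule subst_cong) simp
  moreover have "ss = []" using well_formed_patternsD[OF wf A] by auto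
  ultimately show ?thesis
    using A val \<delta>(1) true by (intro coversI[of ss \<phi> A xs ?\<delta>]) (auto simp: value_term_has_sort[OF L])
qed

section \<open>Value mode: the first variable becomes a prefix variable\<close>

text \<open>The variable \<open>x\<close> enters a constraint only in place of \<open>z\<close>,
  which has the same sort, so theory sorts are preserved. Freshness of \<open>x\<close> preserves
  linearity.\<close>

lemma well_formed_value_step:
  assumes "well_formed_patterns L xs (\<kappa> # \<kappa>s) A"
    and "x \<notin> set xs \<union> pattern_vars A" "var_sort L x = \<kappa>"
  shows "well_formed_patterns L (xs @ [x]) \<kappa>s
    {(ss, subst1 \<phi> z (Var x)) | z ss \<phi>. (Var z # ss, \<phi>) \<in> A}"
  unfolding well_formed_patterns_def
proof clarify
  fix z ss \<phi>
  assume A: "(Var z # ss, \<phi>) \<in> A"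
  then have *: "list_all2 (has_sort L (sig L)) ss \<kappa>s" "var_sort L z = \<kappa>"
    "distinct (xs @ z # concat (map var_occs ss))" "\<forall>x \<in> vars \<phi>. var_sort L x \<in> theory_sorts L"
    using well_formed_patternsD[OF assms(1)] by fastforce+
  have "x \<notin> \<Union>(vars ` set ss)" using A assms(2) by (fastforce simp: pattern_vars_def)
  moreover have "\<forall>y \<in> vars (subst1 \<phi> z (Var x)). var_sort L y \<in> theory_sorts L"
    using *(2,4) assms(3) by (auto simp: vars_subst split: if_splits)
  ultimately show "list_all2 (has_sort L (sig L)) ss \<kappa>s \<and>
      distinct ((xs @ [x]) @ concat (map var_occs ss)) \<and>
      (\<forall>y \<in> vars (subst1 \<phi> z (Var x)). var_sort L y \<in> theory_sorts L)"
    using * assms(2) by auto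
qed

text \<open>A matcher for the shortened pattern sends \<open>x\<close> to \<open>t\<close>. Sending
  \<open>z\<close> to \<open>t\<close> as well gives a matcher for the original one: the constraint
  keeps its truth value because \<open>x\<close> stood for \<open>z\<close>, and by linearity
  \<open>z\<close> occurs neither in \<open>xs\<close> nor in the remaining terms.\<close>

lemma covers_value_step:
  assumes L: "is_lctrs L" and wf: "well_formed_patterns L xs (\<kappa> # \<kappa>s) A"
    and x: "x \<notin> set xs \<union> pattern_vars A"
    and t: "value_term L \<kappa> t"
    and cov: "covers L (xs @ [x]) (\<gamma>(x := t))
      {(ss, subst1 \<phi> z (Var x)) | z ss \<phi>. (Var z # ss, \<phi>) \<in> A} ts"
  shows "covers L xs \<gamma> A (t # ts)"
proof -
  obtain z ss \<phi> \<delta> where A: "(Var z # ss, \<phi>) \<in> A"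
    and \<delta>: "\<And>y. y \<in> set (xs @ [x]) \<Longrightarrow> \<delta> y = (\<gamma>(x := t)) y"
      "\<And>y. has_sort L (sig L) (\<delta> y) (var_sort L y)" "map (\<lambda>s. s \<cdot> \<delta>) ss = ts"
      "\<And>y. y \<in> vars (subst1 \<phi> z (Var x)) \<Longrightarrow> value_term L (var_sort L y) (\<delta> y)"
      "eval_ground L (subst1 \<phi> z (Var x) \<cdot> \<delta>) = tt L"
    using cov by (elim coversE) blast
  have z: "var_sort L z = \<kappa>" "z \<notin> set xs" "z \<notin> \<Union>(vars ` set ss)"
    using well_formed_patternsD[OF wf A] by auto
  have \<delta>x: "\<delta> x = t" using \<delta>(1)[of x] by simp
  show ?thesis
  proof (rule coversI[OF A, of xs "\<delta>(z := t)"])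
    show "(\<delta>(z := t)) y = \<gamma> y" if "y \<in> set xs" for y using \<delta>(1)[of y] that x z(2) by auto
    show "has_sort L (sig L) ((\<delta>(z := t)) y) (var_sort L y)" for y
      using \<delta>(2) z(1) value_term_has_sort[OF L t] by simp
    show "map (\<lambda>s. s \<cdot> \<delta>(z := t)) (Var z # ss) = t # ts"
      using \<delta>(3) z(3) map_subst_upd_idle by fastforce
    show "value_term L (var_sort L y) ((\<delta>(z := t)) y)" if "y \<in> vars \<phi>" for y
    proof (cases "y = z")
      case False
      with that have "y \<in> vars (subst1 \<phi> z (Var x))" by (auto simp: vars_subst intro!: bexI[of _ y])
      then show ?thesis using \<delta>(4) False by simp
    qed (use t z in simp)
    show "eval_ground L (\<phi> \<cdot> \<delta>(z := t)) = tt L" using \<delta>(5) by (simp add: subst1_rename \<delta>x)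
  qed
qed

section \<open>Term mode: dropping the first term or splitting it by its root\<close>

definition first_var_unconstrained :: "('f, 'v) pattern set \<Rightarrow> bool" where
  "first_var_unconstrained A \<longleftrightarrow> (\<forall>z ss \<phi>. (Var z # ss, \<phi>) \<in> A \<longrightarrow> z \<notin> vars \<phi>)"

text \<open>Common core of dropping and splitting. The variable \<open>z\<close> is absent from the
  constraint and, by linearity, from \<open>xs\<close> and \<open>ss\<close>, so it can be
  redirected to any term of its sort, even to one that is not a value.\<close>

lemma covers_instantiate_first_var:
  assumes wf: "well_formed_patterns L xs (\<kappa> # \<kappa>s) A" and A: "(Var z # ss, \<phi>) \<in> A"
    and z: "z \<notin> vars \<phi>" and t: "has_sort L (sig L) t \<kappa>"
    and cov: "\<And>x. x \<in> set xs \<Longrightarrow> \<delta> x = \<gamma> x"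
      "\<And>x. has_sort L (sig L) (\<delta> x) (var_sort L x)" "map (\<lambda>s. s \<cdot> \<delta>) ss = ts"
      "\<And>x. x \<in> vars \<phi> \<Longrightarrow> value_term L (var_sort L x) (\<delta> x)" "eval_ground L (\<phi> \<cdot> \<delta>) = tt L"
  shows "covers L xs \<gamma> A (t # ts)"
proof (rule coversI[OF A, of xs "\<delta>(z := t)"])
  have *: "var_sort L z = \<kappa>" "z \<notin> set xs" "z \<notin> \<Union>(vars ` set ss)"
    using well_formed_patternsD[OF wf A] by auto
  show "(\<delta>(z := t)) y = \<gamma> y" if "y \<in> set xs" for y using cov(1) that *(2) by auto
  show "has_sort L (sig L) ((\<delta>(z := t)) y) (var_sort L y)" for y using cov(2) *(1) t by simp
  show "map (\<lambda>s. s \<cdot> \<delta>(z := t)) (Var z # ss) = t # ts"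
    using cov(3) *(3) map_subst_upd_idle by fastforce
  show "value_term L (var_sort L y) ((\<delta>(z := t)) y)" if "y \<in> vars \<phi>" for y
    using that z cov(4) by auto
  show "eval_ground L (\<phi> \<cdot> \<delta>(z := t)) = tt L" using z cov(5) by (simp add: subst_upd_idle)
qed

lemma covers_drop_var:
  assumes "well_formed_patterns L xs (\<kappa> # \<kappa>s) A" "first_var_unconstrained A"
    and "has_sort L (sig L) t \<kappa>"
    and "covers L xs \<gamma> {(ss, \<phi>) | z ss \<phi>. (Var z # ss, \<phi>) \<in> A} ts"
  shows "covers L xs \<gamma> A (t # ts)"
  using assms(4)
proof (rule coversE)
  fix ss \<phi> \<delta>
  assume "(ss, \<phi>) \<in> {(ss, \<phi>) | z ss \<phi>. (Var z # ss, \<phi>) \<in> A}"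
  then obtain z where z: "(Var z # ss, \<phi>) \<in> A" by blast
  moreover from this assms(2) have "z \<notin> vars \<phi>" by (auto simp: first_var_unconstrained_def)
  moreover assume "\<And>x. x \<in> set xs \<Longrightarrow> \<delta> x = \<gamma> x"
    "\<And>x. has_sort L (sig L) (\<delta> x) (var_sort L x)" "map (\<lambda>s. s \<cdot> \<delta>) ss = ts"
    "\<And>x. x \<in> vars \<phi> \<Longrightarrow> value_term L (var_sort L x) (\<delta> x)" "eval_ground L (\<phi> \<cdot> \<delta>) = tt L"
  ultimately show ?thesis by (rule covers_instantiate_first_var[OF assms(1) _ _ assms(3)])
qed

lemma well_formed_drop_var:
  assumes "well_formed_patterns L xs (\<kappa> # \<kappa>s) A"
  shows "well_formed_patterns L xs \<kappa>s {(ss, \<phi>) | z ss \<phi>. (Var z # ss, \<phi>) \<in> A}"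
  using assms unfolding well_formed_patterns_def by fastforce

text \<open>The set that clause \<open>term_flag_split\<close> hands on for one constructor.\<close>

abbreviation split_patterns :: "'f \<Rightarrow> 'v list \<Rightarrow> ('f, 'v) pattern set \<Rightarrow> ('f, 'v) pattern set" where
  "split_patterns f ys A \<equiv>
     {(ts @ ss, \<phi>) | ts ss \<phi>. (Fun f ts # ss, \<phi>) \<in> A} \<union>
     {(map Var ys @ ss, subst1 \<phi> z (Fun f (map Var ys))) | z ss \<phi>. (Var z # ss, \<phi>) \<in> A}"

lemma concat_map_var_occs_Var [simp]: "concat (map (var_occs \<circ> Var) ys) = ys"
  by (induction ys) auto

text \<open>Flattening \<open>Fun f ts\<close> to its arguments keeps all variable occurrences, and
  a leading variable gives way to distinct fresh ones. The constraint stays the same because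
  \<open>z\<close> is not in it; otherwise the new term could bring in variables of arbitrary
  sorts.\<close>

lemma well_formed_split:
  assumes wf: "well_formed_patterns L xs (\<kappa> # \<kappa>s) A" and fv: "first_var_unconstrained A"
    and ys: "distinct ys" "map (var_sort L) ys = arg_sorts L f"
      "set ys \<inter> (set xs \<union> pattern_vars A) = {}"
  shows "well_formed_patterns L xs (arg_sorts L f @ \<kappa>s) (split_patterns f ys A)"
  unfolding well_formed_patterns_def
proof (clarify, elim UnE CollectE exE conjE Pair_inject)
  fix ss' \<phi>' ts ss \<phi>
  assume eq: "ss' = ts @ ss" "\<phi>' = \<phi>" and "(Fun f ts # ss, \<phi>) \<in> A"
  with wf show "list_all2 (has_sort L (sig L)) ss' (arg_sorts L f @ \<kappa>s) \<and>
      distinct (xs @ concat (map var_occs ss')) \<and> (\<forall>x \<in> vars \<phi>'. var_sort L x \<in> theory_sorts L)"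
    unfolding well_formed_patterns_def by (fastforce intro: list_all2_appendI)
next
  fix ss' \<phi>' z ss \<phi>
  assume eq: "ss' = map Var ys @ ss" "\<phi>' = subst1 \<phi> z (Fun f (map Var ys))"
    and A: "(Var z # ss, \<phi>) \<in> A"
  have "\<phi>' = \<phi>" using fv A by (simp add: eq subst1_idle first_var_unconstrained_def)
  moreover have "list_all2 (has_sort L (sig L)) (map Var ys) (arg_sorts L f)"
    by (simp add: ys(2)[symmetric] list_all2_conv_all_nth)
  moreover have "set ys \<inter> \<Union>(vars ` set ss) = {}"
    using A ys(3) by (fastforce simp: pattern_vars_def)
  moreover have "list_all2 (has_sort L (sig L)) ss \<kappa>s" "\<forall>x \<in> vars \<phi>. var_sort L x \<in> theory_sorts L"
    "distinct (xs @ concat (map var_occs ss))"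
    using well_formed_patternsD[OF wf A] by auto
  ultimately show "list_all2 (has_sort L (sig L)) ss' (arg_sorts L f @ \<kappa>s) \<and>
      distinct (xs @ concat (map var_occs ss')) \<and> (\<forall>x \<in> vars \<phi>'. var_sort L x \<in> theory_sorts L)"
    using ys(1,3) by (auto simp: eq(1) intro: list_all2_appendI)
qed

text \<open>The arity of \<open>f\<close> determines where the matched list divides into
  \<open>us\<close> and \<open>ts\<close>. If the pattern came from a term with root
  \<open>f\<close>, the same matcher works; if it came from a variable \<open>z\<close>, then
  \<open>z\<close> is sent to the whole term \<open>Fun f us\<close>.\<close>

lemma covers_split:
  assumes wf: "well_formed_patterns L xs (\<kappa> # \<kappa>s) A" and fv: "first_var_unconstrained A"
    and ys: "map (var_sort L) ys = arg_sorts L f"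
    and t: "has_sort L (sig L) (Fun f us) \<kappa>"
    and cov: "covers L xs \<gamma> (split_patterns f ys A) (us @ ts)"
  shows "covers L xs \<gamma> A (Fun f us # ts)"
  using cov
proof (rule coversE)
  fix ss' \<phi>' \<delta>
  assume mem: "(ss', \<phi>') \<in> split_patterns f ys A"
    and \<delta>: "\<And>x. x \<in> set xs \<Longrightarrow> \<delta> x = \<gamma> x" "\<And>x. has_sort L (sig L) (\<delta> x) (var_sort L x)"
      "map (\<lambda>s. s \<cdot> \<delta>) ss' = us @ ts"
      "\<And>x. x \<in> vars \<phi>' \<Longrightarrow> value_term L (var_sort L x) (\<delta> x)" "eval_ground L (\<phi>' \<cdot> \<delta>) = tt L"
  have len: "length us = length (arg_sorts L f)" using t by (auto dest: list_all2_lengthD)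
  from mem show ?thesis
  proof (elim UnE CollectE exE conjE Pair_inject)
    fix qs ss \<phi>
    assume eq: "ss' = qs @ ss" "\<phi>' = \<phi>" and A: "(Fun f qs # ss, \<phi>) \<in> A"
    have "length qs = length us"
      using well_formed_patternsD(1)[OF wf A] len by (auto dest: list_all2_lengthD)
    then have "map (\<lambda>s. s \<cdot> \<delta>) (Fun f qs # ss) = Fun f us # ts"
      using \<delta>(3) by (simp add: eq(1) append_eq_append_conv)
    then show ?thesis by (intro coversI[OF A, of xs \<delta>]) (use \<delta> eq(2) in auto)
  next
    fix z ss \<phi>
    assume eq: "ss' = map Var ys @ ss" "\<phi>' = subst1 \<phi> z (Fun f (map Var ys))"
      and A: "(Var z # ss, \<phi>) \<in> A"
    have z: "z \<notin> vars \<phi>" using fv A by (simp add: first_var_unconstrained_def)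
    then have "\<phi>' = \<phi>" by (simp add: eq(2) subst1_idle)
    moreover have "length ys = length us" using len ys by (metis length_map)
    then have "map (\<lambda>s. s \<cdot> \<delta>) ss = ts"
      using \<delta>(3) by (simp add: eq(1) append_eq_append_conv)
    ultimately show ?thesis
      using covers_instantiate_first_var[OF wf A z t, of \<delta>] \<delta> by simp
  qed
qed

text \<open>The last two hypotheses read the flag as knowledge about the first term of
  \<open>ts\<close>. They are vacuous for \<open>Either_Flag\<close>, to which every clause that
  consumes or splits the first term returns.\<close>

lemma OK_covers:
  fixes L :: "('f, 'v, 's, 'd) lctrs"
  assumes L: "is_lctrs L" and "OK L xs \<kappa>s A b"
    and "well_formed_patterns L xs \<kappa>s A"
    and "list_all2 (\<lambda>t \<kappa>. ground t \<and> has_sort L (constructors L) t \<kappa>) ts \<kappa>s"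
    and "\<forall>x \<in> set xs. value_term L (var_sort L x) (\<gamma> x)"
    and "b = Value_Flag \<and> \<kappa>s \<noteq> [] \<Longrightarrow> value_term L (hd \<kappa>s) (hd ts)"
    and "b = Term_Flag \<and> \<kappa>s \<noteq> [] \<Longrightarrow>
      \<not> value_term L (hd \<kappa>s) (hd ts) \<and> first_var_unconstrained A"
  shows "covers L xs \<gamma> A ts"
  using assms(2-)
proof (induction arbitrary: ts \<gamma>)
  case (no_terms xs A b)
  then show ?case using covers_no_terms[OF L] by simp
next
  case (either_term \<kappa> xs \<kappa>s A)
  obtain t ts' where ts: "ts = t # ts'" using either_term.prems(2) by (auto simp: list_all2_Cons2)
  \<comment> \<open>Outside the theory sorts there are neither values nor constraint variables,
    which gives both requirements of term mode.\<close>
  have "\<not> value_term L \<kappa> t" using either_term.hyps value_term_theory_sort[OF L] by blast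
  moreover have "first_var_unconstrained A"
    using either_term.prems(1) either_term.hyps(1)
    by (fastforce simp: first_var_unconstrained_def well_formed_patterns_def)
  ultimately show ?case using either_term ts by simp
next
  case (either_value \<kappa> xs \<kappa>s A)
  obtain t ts' where ts: "ts = t # ts'" "ground t" "has_sort L (constructors L) t \<kappa>"
    using either_value.prems(2) by (auto simp: list_all2_Cons2)
  \<comment> \<open>With no non-value constructor of this sort, only a value can be at the
    root.\<close>
  then have "value_term L \<kappa> t"
    using ground_constructor_term_cases[OF L] either_value.hyps(2) by (metis empty_iff)
  then show ?case using either_value ts by simp
next
  case (either_both \<kappa> xs \<kappa>s A)
  obtain t ts' where ts: "ts = t # ts'" using either_both.prems(2) by (auto simp: list_all2_Cons2)
  let ?V = "{(ss, \<phi>) \<in> A. is_Var (hd ss)}" and ?T = "{(ss, \<phi>) \<in> A. hd ss \<notin> Var ` vars \<phi>}"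
  have sub: "?V \<subseteq> A" "?T \<subseteq> A" by auto
  \<comment> \<open>A given tuple concerns only one of the two recursive calls: \<open>?V\<close> if
    \<open>t\<close> is a value, \<open>?T\<close> otherwise. The patterns left out of
    \<open>?T\<close> are those that would violate \<open>first_var_unconstrained\<close>.\<close>
  show ?case
  proof (cases "value_term L \<kappa> t")
    case True
    then have "covers L xs \<gamma> ?V ts"
      using either_both.prems ts well_formed_patterns_mono[OF _ sub(1)]
      by (intro either_both.IH(1)) auto
    then show ?thesis using covers_mono sub(1) by blast
  next
    case False
    have "first_var_unconstrained ?T" by (auto simp: first_var_unconstrained_def)
    with False have "covers L xs \<gamma> ?T ts"
      using either_both.prems ts well_formed_patterns_mono[OF _ sub(2)]
      by (intro either_both.IH(2)) auto
    then show ?thesis using covers_mono sub(2) by blast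
  qed
next
  case (value_flag A x xs \<kappa> \<kappa>s)
  obtain t ts' where ts: "ts = t # ts'"
    "list_all2 (\<lambda>t \<kappa>. ground t \<and> has_sort L (constructors L) t \<kappa>) ts' \<kappa>s"
    using value_flag.prems(2) by (auto simp: list_all2_Cons2)
  have t: "value_term L \<kappa> t" using value_flag.prems(4) ts by simp
  \<comment> \<open>The value \<open>t\<close> moves from the tuple into the assignment of the
    prefix, which is why \<open>\<gamma>\<close> is arbitrary in the induction.\<close>
  have "covers L (xs @ [x]) (\<gamma>(x := t))
      {(ss, subst1 \<phi> z (Var x)) | z ss \<phi>. (Var z # ss, \<phi>) \<in> A} ts'"
    by (rule value_flag.IH)
      (use value_flag.prems value_flag.hyps well_formed_value_step[OF value_flag.prems(1)] ts t in auto)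
  then show ?case
    using covers_value_step[OF L value_flag.prems(1) value_flag.hyps(2) t] ts by simp
next
  case (term_flag_vars A xs \<kappa>s \<kappa>)
  obtain t ts' where ts: "ts = t # ts'" "has_sort L (constructors L) t \<kappa>"
    "list_all2 (\<lambda>t \<kappa>. ground t \<and> has_sort L (constructors L) t \<kappa>) ts' \<kappa>s"
    using term_flag_vars.prems(2) by (auto simp: list_all2_Cons2)
  have "covers L xs \<gamma> {(ss, \<phi>) | z ss \<phi>. (Var z # ss, \<phi>) \<in> A} ts'"
    by (rule term_flag_vars.IH[OF well_formed_drop_var[OF term_flag_vars.prems(1)] ts(3)
          term_flag_vars.prems(3)]) simp_all
  moreover have "has_sort L (sig L) t \<kappa>"
    by (rule has_sort_mono[OF ts(2) constructors_subset_sig[OF L]])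
  ultimately show ?case
    using covers_drop_var[OF term_flag_vars.prems(1)] term_flag_vars.prems(5) ts(1) by simp
next
  case (term_flag_split A \<kappa> ys xs \<kappa>s)
  obtain t ts' where ts: "ts = t # ts'" "ground t" "has_sort L (constructors L) t \<kappa>"
    "list_all2 (\<lambda>t \<kappa>. ground t \<and> has_sort L (constructors L) t \<kappa>) ts' \<kappa>s"
    using term_flag_split.prems(2) by (auto simp: list_all2_Cons2)
  have nv: "\<not> value_term L \<kappa> t" and fv: "first_var_unconstrained A"
    using term_flag_split.prems(5) ts(1) by simp_all
  \<comment> \<open>The root of \<open>t\<close> selects the conjunct of the splitting clause to be
    used.\<close>
  obtain f us where t: "t = Fun f us" and f: "f \<in> nonvalue_constructors_of L \<kappa>"
    and us: "list_all2 (\<lambda>t \<iota>. ground t \<and> has_sort L (constructors L) t \<iota>) us (arg_sorts L f)"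
    using ground_constructor_term_cases[OF L ts(2,3) nv] .
  have ys: "distinct (ys f)" "map (var_sort L) (ys f) = arg_sorts L f"
    "set (ys f) \<inter> (set xs \<union> pattern_vars A) = {}"
    using term_flag_split.hyps(2)[OF f] by auto
  have "covers L xs \<gamma> (split_patterns f (ys f) A) (us @ ts')"
    using well_formed_split[OF term_flag_split.prems(1) fv ys] us ts(4) term_flag_split.prems(3)
    by (intro term_flag_split.IH[OF f]) (auto intro: list_all2_appendI)
  moreover have "has_sort L (sig L) (Fun f us) \<kappa>"
    by (rule has_sort_mono[OF ts(3)[unfolded t] constructors_subset_sig[OF L]])
  ultimately show ?case
    using covers_split[OF term_flag_split.prems(1) fv ys(2)] unfolding ts(1) t by blast
qed

section \<open>From coverage to a rewrite step at the root\<close>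

text \<open>Each sort has infinitely many variables, so they can be picked one by one. This gives a
  witness for the choice in \<open>calc_vars\<close>.\<close>

lemma ex_distinct_vars_of_sorts:
  assumes "\<And>\<iota>. infinite {x. var_sort L x = \<iota>}"
  shows "\<exists>zs. distinct zs \<and> map (var_sort L) zs = \<kappa>s"
proof (induction \<kappa>s)
  case (Cons \<kappa> \<kappa>s)
  then obtain zs where zs: "distinct zs" "map (var_sort L) zs = \<kappa>s" by blast
  obtain z where "var_sort L z = \<kappa>" "z \<notin> set zs"
    using finite_subset[of "{x. var_sort L x = \<kappa>}" "set zs"] assms[of \<kappa>] by blast
  with zs show ?case by (intro exI[of _ "z # zs"]) simp
qed simp

lemma calc_vars_Cons:
  assumes "is_lctrs L"
  obtains y xs where "calc_vars L f = y # xs" "distinct (y # xs)"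
    "var_sort L y = out_sort L f" "map (var_sort L) xs = arg_sorts L f"
proof -
  have inf: "infinite {x. var_sort L x = \<iota>}" for \<iota>
    using assms by (simp add: is_lctrs_def)
  have "distinct (calc_vars L f) \<and> map (var_sort L) (calc_vars L f) = out_sort L f # arg_sorts L f"
    unfolding calc_vars_def by (rule someI_ex) (rule ex_distinct_vars_of_sorts[OF inf])
  then show ?thesis using that by (auto simp: map_eq_Cons_conv)
qed

text \<open>Calculation rules have by construction what is assumed of the other rules, since their
  variables are distinct and of theory sorts. The first three facts make \<open>lhs_patterns\<close>
  well-formed; the last one supplies values for fresh right-hand side variables.\<close>

lemma all_rules_properties:
  assumes L: "is_lctrs L" and "left_linear L" and "(Fun f ls, r, \<phi>) \<in> all_rules L"
  shows "list_all2 (has_sort L (sig L)) ls (arg_sorts L f)"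
    and "distinct (concat (map var_occs ls))"
    and "\<forall>x \<in> vars \<phi>. var_sort L x \<in> theory_sorts L"
    and "\<forall>x \<in> vars r - vars (Fun f ls). var_sort L x \<in> theory_sorts L"
proof -
  have "list_all2 (has_sort L (sig L)) ls (arg_sorts L f) \<and> distinct (concat (map var_occs ls)) \<and>
      (\<forall>x \<in> vars \<phi>. var_sort L x \<in> theory_sorts L) \<and>
      (\<forall>x \<in> vars r - vars (Fun f ls). var_sort L x \<in> theory_sorts L)"
  proof (cases "(Fun f ls, r, \<phi>) \<in> rules L")
    case True
    then have wf: "wf_rule L (Fun f ls, r, \<phi>)" using L by (auto simp: is_lctrs_def)
    have "distinct (var_occs (Fun f ls))" using assms(2) True unfolding left_linear_def by blast
    moreover have "\<forall>x \<in> vars \<phi>. var_sort L x \<in> theory_sorts L"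
      using wf L has_sort_vars_theory[of L "sig_theory L" \<phi> "bool_sort L"]
      by (auto simp: wf_rule_def is_constraint_def is_lctrs_def)
    ultimately show ?thesis using wf by (auto simp: wf_rule_def)
  next
    case False
    then obtain g where g: "g \<in> calc_symbols L" "calc_rule L g = (Fun f ls, r, \<phi>)"
      using assms(3) by (auto simp: all_rules_def)
    obtain y xs where c: "calc_vars L g = y # xs" "distinct (y # xs)"
      "var_sort L y = out_sort L g" "map (var_sort L) xs = arg_sorts L g"
      using calc_vars_Cons[OF L] .
    have eq: "f = g" "ls = map Var xs" "r = Var y"
      "\<phi> = Fun (eq_sym L (out_sort L g)) [Var y, Fun g (map Var xs)]"
      using g(2) by (auto simp: calc_rule_def Let_def c(1))
    have "insert (out_sort L g) (set (arg_sorts L g)) \<subseteq> theory_sorts L"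
      using g(1) by (auto simp: calc_symbols_def theory_sorts_def)
    then have "var_sort L ` set (y # xs) \<subseteq> theory_sorts L" by (simp add: c(3) flip: c(4))
    moreover have "list_all2 (has_sort L (sig L)) (map Var xs) (arg_sorts L g)"
      by (simp add: c(4)[symmetric] list_all2_conv_all_nth)
    ultimately show ?thesis using c(2) by (auto simp: eq)
  qed
  then show "list_all2 (has_sort L (sig L)) ls (arg_sorts L f)"
    "distinct (concat (map var_occs ls))" "\<forall>x \<in> vars \<phi>. var_sort L x \<in> theory_sorts L"
    "\<forall>x \<in> vars r - vars (Fun f ls). var_sort L x \<in> theory_sorts L" by blast+
qed

lemma rstep_root_if_covers:
  assumes L: "is_lctrs L" and "left_linear L" and "covers L [] \<gamma> (lhs_patterns L f) ts"
  shows "\<exists>u. rstep L (Fun f ts) u"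
  using assms(3)
proof (rule coversE)
  fix ls \<phi> \<delta>
  assume "(ls, \<phi>) \<in> lhs_patterns L f"
    and \<delta>: "\<And>x. has_sort L (sig L) (\<delta> x) (var_sort L x)" "map (\<lambda>s. s \<cdot> \<delta>) ls = ts"
      "\<And>x. x \<in> vars \<phi> \<Longrightarrow> value_term L (var_sort L x) (\<delta> x)" "eval_ground L (\<phi> \<cdot> \<delta>) = tt L"
  then obtain r where rule: "(Fun f ls, r, \<phi>) \<in> all_rules L" by (auto simp: lhs_patterns_def)
  \<comment> \<open>A step also needs values for the right-hand side variables that neither the
    left-hand side nor the constraint mentions. Choosing them anew on \<open>Y\<close> affects
    neither the match nor the truth of \<open>\<phi>\<close>.\<close>
  define Y where "Y = vars r - vars (Fun f ls) - vars \<phi>"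
  have "\<exists>t. value_term L (var_sort L x) t" if "x \<in> Y" for x
    using that all_rules_properties(4)[OF assms(1,2) rule]
    by (intro ex_value_term[OF L]) (auto simp: Y_def)
  then obtain w where w: "value_term L (var_sort L x) (w x)" if "x \<in> Y" for x by metis
  let ?\<delta> = "\<lambda>x. if x \<in> Y then w x else \<delta> x"
  have "Fun f ls \<cdot> ?\<delta> = Fun f ls \<cdot> \<delta>" "\<phi> \<cdot> ?\<delta> = \<phi> \<cdot> \<delta>"
    by (rule subst_cong, force simp: Y_def)+
  then have lhs: "Fun f ls \<cdot> ?\<delta> = Fun f ts" and "eval_ground L (\<phi> \<cdot> ?\<delta>) = tt L"
    using \<delta> by simp_all
  moreover have "value_term L (var_sort L x) (?\<delta> x)" if "x \<in> vars \<phi> \<union> (vars r - vars (Fun f ls))" for x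
    using that w \<delta>(3) by (auto simp: Y_def)
  ultimately have "respects_rule L ?\<delta> (Fun f ls, r, \<phi>)"
    unfolding respects_rule_def by blast
  moreover have "has_sort L (sig L) (?\<delta> x) (var_sort L x)" for x
    using w \<delta>(1) value_term_has_sort[OF L] by simp
  ultimately have "rstep L (Fun f ls \<cdot> ?\<delta>) (r \<cdot> ?\<delta>)" by (intro rstep.root[OF rule])
  then show ?thesis unfolding lhs by blast
qed

theorem theoremB6:
  fixes L :: "('f, 'v, 's, 'd) lctrs"
  assumes "is_lctrs L"
    and "left_linear L"
    and "left_value_free L"
    and "constructor_sound L"
    and "constructor_system L"
    and "\<And>f. f \<in> defined_symbols L \<union> calc_symbols L
           \<Longrightarrow> OK L [] (arg_sorts L f) (lhs_patterns L f) Either_Flag"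
  shows "quasi_reductive L"
proof -
  have "ground t \<Longrightarrow> has_sort L (constructors L) t \<iota> \<or> (\<exists>u. rstep L t u)"
    if "has_sort L (sig L) t \<iota>" for t \<iota>
    using that
  proof induction
    case (Fun f ts)
    have g: "ground s" if "s \<in> set ts" for s using Fun.prems that by (auto simp: ground_def)
    show ?case
    proof (cases "\<exists>s \<in> set ts. \<exists>u. rstep L s u")
      case True
      then obtain us s vs u where "ts = us @ s # vs" "rstep L s u" by (metis split_list)
      then show ?thesis by (blast intro: rstep.ctxt)
    next
      case False
      \<comment> \<open>Since no argument reduces, the induction hypothesis makes each one a
        constructor term.\<close>
      then have args: "list_all2 (\<lambda>t \<kappa>. ground t \<and> has_sort L (constructors L) t \<kappa>) ts (arg_sorts L f)"
        using Fun.IH g by (auto simp: list_all2_conv_all_nth)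
      show ?thesis
      proof (cases "f \<in> constructors L")
        case True
        then show ?thesis using args by (auto simp: list_all2_conv_all_nth)
      next
        case False
        then have "f \<in> defined_symbols L \<union> calc_symbols L"
          using Fun.hyps by (auto simp: sig_def constructors_def calc_symbols_def)
        then have ok: "OK L [] (arg_sorts L f) (lhs_patterns L f) Either_Flag" by (rule assms(6))
        have "well_formed_patterns L [] (arg_sorts L f) (lhs_patterns L f)"
          using all_rules_properties(1-3)[OF assms(1,2)]
          unfolding well_formed_patterns_def lhs_patterns_def by fastforce
        \<comment> \<open>There are no prefix variables yet, so the assignment \<open>Var\<close> is
          an arbitrary choice.\<close>
        then have "covers L [] Var (lhs_patterns L f) ts"
          using args by (intro OK_covers[OF assms(1) ok]) auto
        then show ?thesis using rstep_root_if_covers[OF assms(1,2)] by blast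
      qed
    qed
  qed (simp add: ground_def)
  then show ?thesis by (simp add: quasi_reductive_def)
qed

end
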